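(* Let $S=\{\vec a=(a_0,\dots,a_N): a_0,a_N>0,\ a_1,\dots,a_{N-1}\ge0\}$. For any $\vec a,\vec a'\in S$ and any $y,y'\in\mathbb R^d$, put $$\gamma(t)=ty+(1-t)y',\qquad \vec b(t)=t\vec a+(1-t)\vec a',\qquad d_0=N\left(\min\{a_0,a_0',(1+\alpha_N)a_N,(1+\alpha_N)a_N'\}\right)^{-1}.$$ Then: (i) $$|K(|y|,\vec a)y-K(|y'|,\vec a')y'|\le(1+a)|y-y'|\int_0^1K(|\gamma(t)|,\vec b(t))\,dt+d_0\,(|y|\vee|y'|)\,|\vec a-\vec a'|\int_0^1K(|\gamma(t)|,\vec b(t))\,dt.$$ (ii) $$(K(|y|,\vec a)y-K(|y'|,\vec a')y')\cdot(y-y')\ge(1-a)|y-y'|^2\int_0^1K(|\gamma(t)|,\vec b(t))\,dt-d_0\,(|y|\vee|y'|)\,|\vec a-\vec a'|\,|y-y'|\int_0^1K(|\gamma(t)|,\vec b(t))\,dt.$$ In particular, if $\vec a=\vec a'$, then, writing $K(\cdot)=K(\cdot,\vec a)$: (iii) $$|K(|y'|)y'-K(|y|)y|\le(1+a)|y'-y|\int_0^1K(|\gamma(t)|,\vec a)\,dt.$$ (iv) $$(K(|y'|)y'-K(|y|)y)\cdot(y'-y)\ge(1-a)|y'-y|^2\int_0^1K(|\gamma(t)|,\vec a)\,dt.$$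
   Context: $d\ge2$, $N\ge1$, and real exponents $0=\alpha_0<\alpha_1<\dots<\alpha_N$ are fixed. For $\vec a\in S$, $g(s,\vec a)=\sum_{i=0}^N a_is^{\alpha_i}$ for $s\ge0$, and $K(\xi,\vec a)=1/g(s(\xi,\vec a),\vec a)$ for $\xi\ge0$, where $s(\xi,\vec a)$ is the unique non-negative solution $s$ of $s\,g(s,\vec a)=\xi$. The number $a=\frac{\alpha_N}{\alpha_N+1}\in(0,1)$. For real numbers, $x\vee x'=\max\{x,x'\}$. $|\cdot|$ is the Euclidean norm. *)

theory Defs
  imports "HOL-Analysis.Analysis"
begin

text \<open>
  A coefficient vector $(a_0,\dots,a_N)$ is a function of type \<^typ>\<open>nat \<Rightarrow> real\<close> of which only
  the values at \<open>0, \<dots>, N\<close> matter; the exponents $\alpha_0,\dots,\alpha_N$ are treated likewise.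
\<close>

definition coeff_set :: "nat \<Rightarrow> (nat \<Rightarrow> real) set" where
  "coeff_set N = {a. a 0 > 0 \<and> a N > 0 \<and> (\<forall>i\<in>{1..<N}. a i \<ge> 0)}"

text \<open>Since \<^term>\<open>0 powr 0 = (0::real)\<close>, the convention $0^0 = 1$ (so that $g(0,a) = a_0$) has to be
  imposed separately.\<close>

definition rpow :: "real \<Rightarrow> real \<Rightarrow> real" where
  "rpow s p = (if p = 0 then 1 else s powr p)"

definition gfun :: "nat \<Rightarrow> (nat \<Rightarrow> real) \<Rightarrow> real \<Rightarrow> (nat \<Rightarrow> real) \<Rightarrow> real" where
  "gfun N \<alpha> s a = (\<Sum>i=0..N. a i * rpow s (\<alpha> i))"

definition sfun :: "nat \<Rightarrow> (nat \<Rightarrow> real) \<Rightarrow> real \<Rightarrow> (nat \<Rightarrow> real) \<Rightarrow> real" where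
  "sfun N \<alpha> \<xi> a = (THE s. s \<ge> 0 \<and> s * gfun N \<alpha> s a = \<xi>)"

definition Kfun :: "nat \<Rightarrow> (nat \<Rightarrow> real) \<Rightarrow> real \<Rightarrow> (nat \<Rightarrow> real) \<Rightarrow> real" where
  "Kfun N \<alpha> \<xi> a = 1 / gfun N \<alpha> (sfun N \<alpha> \<xi> a) a"

text \<open>The number denoted by the scalar $a$ in the mathematical text.\<close>

definition deg_exp :: "nat \<Rightarrow> (nat \<Rightarrow> real) \<Rightarrow> real" where
  "deg_exp N \<alpha> = \<alpha> N / (\<alpha> N + 1)"

definition seg_pt :: "'v::real_vector \<Rightarrow> 'v \<Rightarrow> real \<Rightarrow> 'v" where
  "seg_pt y y' t = t *\<^sub>R y + (1 - t) *\<^sub>R y'"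

definition seg_coeff :: "(nat \<Rightarrow> real) \<Rightarrow> (nat \<Rightarrow> real) \<Rightarrow> real \<Rightarrow> nat \<Rightarrow> real" where
  "seg_coeff a a' t = (\<lambda>i. t * a i + (1 - t) * a' i)"

definition coeff_dist :: "nat \<Rightarrow> (nat \<Rightarrow> real) \<Rightarrow> (nat \<Rightarrow> real) \<Rightarrow> real" where
  "coeff_dist N a a' = L2_set (\<lambda>i. a i - a' i) {0..N}"

definition d0 :: "nat \<Rightarrow> (nat \<Rightarrow> real) \<Rightarrow> (nat \<Rightarrow> real) \<Rightarrow> (nat \<Rightarrow> real) \<Rightarrow> real" where
  "d0 N \<alpha> a a' =
     real N * inverse (Min {a 0, a' 0, (1 + \<alpha> N) * a N, (1 + \<alpha> N) * a' N})"

text \<open>The definite description in \<^const>\<open>sfun\<close> is justified:\<close>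

lemma gfun_continuous_on:
  assumes "\<And>i. i \<le> N \<Longrightarrow> 0 \<le> \<alpha> i"
  shows "continuous_on {0..} (\<lambda>s. gfun N \<alpha> s a)"
proof -
  have "continuous_on {0..} (\<lambda>s. rpow s (\<alpha> i))" if "i \<le> N" for i
  proof (cases "\<alpha> i = 0")
    case False
    then have "0 < \<alpha> i" using assms[OF that] by simp
    then have "continuous_on {0..} (\<lambda>s. s powr \<alpha> i)"
      by (intro continuous_on_powr') (auto intro: continuous_intros)
    with False show ?thesis by (simp add: rpow_def)
  qed (simp add: rpow_def)
  then show ?thesis
    unfolding gfun_def by (intro continuous_on_sum continuous_on_mult continuous_on_const) auto
qed

lemma sfun_unique_exists:
  assumes N: "N \<ge> 1" and \<alpha>0: "\<alpha> 0 = 0" and \<alpha>: "strict_mono_on {0..N} \<alpha>"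
    and a: "a \<in> coeff_set N" and \<xi>: "\<xi> \<ge> 0"
  shows "\<exists>!s. s \<ge> 0 \<and> s * gfun N \<alpha> s a = \<xi>"
proof -
  have \<alpha>nn: "0 \<le> \<alpha> i" if "i \<le> N" for i
    using strict_mono_onD[OF \<alpha>, of 0 i] \<alpha>0 that by (cases "i = 0") auto
  have ann: "0 \<le> a i" if "i \<le> N" for i
    using a that by (cases "i = 0"; cases "i = N") (auto simp: coeff_set_def)
  have a0: "0 < a 0" using a by (simp add: coeff_set_def)
  have lower: "a 0 \<le> gfun N \<alpha> s a" for s
  proof -
    have "a 0 * rpow s (\<alpha> 0) \<le> gfun N \<alpha> s a"
      unfolding gfun_def
      by (rule member_le_sum) (auto simp: rpow_def ann)
    then show ?thesis by (simp add: rpow_def \<alpha>0)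
  qed
  have mono: "gfun N \<alpha> s a \<le> gfun N \<alpha> t a" if "0 \<le> s" "s \<le> t" for s t
    unfolding gfun_def
    by (intro sum_mono mult_left_mono) (auto simp: rpow_def ann \<alpha>nn that intro: powr_mono2)
  have strict: "s * gfun N \<alpha> s a < t * gfun N \<alpha> t a" if "0 \<le> s" "s < t" for s t
  proof -
    have "s * gfun N \<alpha> s a \<le> s * gfun N \<alpha> t a"
      using that by (intro mult_left_mono mono) auto
    also have "\<dots> < t * gfun N \<alpha> t a"
      using that lower[of t] a0 by (intro mult_strict_right_mono) auto
    finally show ?thesis .
  qed
  have "\<exists>s\<ge>0. s \<le> \<xi> / a 0 \<and> s * gfun N \<alpha> s a = \<xi>"
  proof (rule IVT')
    have "\<xi> / a 0 * a 0 \<le> \<xi> / a 0 * gfun N \<alpha> (\<xi> / a 0) a"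
      using lower \<xi> a0 by (intro mult_left_mono) auto
    then show "\<xi> \<le> \<xi> / a 0 * gfun N \<alpha> (\<xi> / a 0) a" using a0 by simp
    show "continuous_on {0..\<xi> / a 0} (\<lambda>s. s * gfun N \<alpha> s a)"
      by (intro continuous_on_mult continuous_on_id
          continuous_on_subset[OF gfun_continuous_on[OF \<alpha>nn]]) auto
  qed (use \<xi> a0 in auto)
  then show ?thesis
    by (metis strict linorder_neqE_linordered_idom less_irrefl)
qed

end

theory Submission
  imports Defs
begin

text \<open>
  Join the data \<open>(y', a')\<close> to \<open>(y, a)\<close> by the segment \<open>(\<gamma> t, b t)\<close> and integrate the derivative of
  the flux \<open>K(\<bar>\<gamma> t\<bar>, b t) \<gamma> t\<close> over \<open>[0, 1]\<close>; all the estimates hold pointwise under the integral.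

  Write \<open>\<rho> = \<bar>\<gamma>\<bar>\<close>, \<open>u = \<gamma> / \<rho>\<close>, \<open>v = y - y'\<close> and \<open>\<sigma> = s(\<rho>, b)\<close>, so that \<open>K = 1 / g(\<sigma>, b) = \<sigma> / \<rho>\<close>. With
  \<open>D\<close> the derivative of \<open>s g(s, b)\<close> at \<open>\<sigma>\<close> and \<open>c = g(\<sigma>, a) - g(\<sigma>, a')\<close>, differentiating
  \<open>\<sigma> g(\<sigma>, b) = \<rho>\<close> implicitly shows that the flux has derivative
  \<open>K v + ((1/D - K) (u \<bullet> v) - \<sigma> c / D) u\<close> wherever \<open>\<gamma>\<close> is nonzero (\<open>flux_has_vector_derivative\<close>).

  The first term contributes \<open>K v\<close>. The second is at most \<open>deg_exp N \<alpha>\<close> times as large, because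
  \<open>(1 - deg_exp N \<alpha>) K \<le> 1/D \<le> K\<close> (\<open>inverse_dflux_bounds\<close>). In the last, \<open>\<sigma> = \<rho> K\<close> and \<open>\<bar>c\<bar> / D\<close> is at most
  \<open>d0\<close> times the distance of the coefficient vectors (\<open>gfun_diff_le_dflux\<close>): up to the factors \<open>N\<close> and the
  minimum in \<open>d0\<close>, both numerator and denominator compare with the sum of \<open>1\<close> and the largest power of \<open>\<sigma>\<close>.
  Taking norms, or the inner product with \<open>v\<close>, and integrating gives the two general estimates
  (\<open>flux_difference_bounds\<close>). The flux is continuous, so the possible zero of \<open>\<gamma>\<close> does no harm. If the
  coefficient vectors agree, their distance vanishes and \<open>b\<close> is constant.
\<close>

section \<open>Differentiating an implicitly defined function\<close>

text \<open>Caratheodory's form of the derivative makes this special case of the implicit function theorem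
  elementary: near \<open>t0\<close> the equation reads \<open>R t = Q t * (\<sigma> t - \<sigma> t0)\<close>, with
  \<open>R t = r t - t * A (\<sigma> t0) - (1 - t) * B (\<sigma> t0)\<close> differentiable and vanishing at \<open>t0\<close> and with
  \<open>Q\<close> continuous and nonzero at \<open>t0\<close>.\<close>

lemma DERIV_implicit_interpolation:
  fixes A B \<sigma> r :: "real \<Rightarrow> real"
  assumes \<sigma>: "isCont \<sigma> t0"
    and A: "DERIV A (\<sigma> t0) :> p" and B: "DERIV B (\<sigma> t0) :> q"
    and r: "DERIV r t0 :> r'"
    and eq: "eventually (\<lambda>t. t * A (\<sigma> t) + (1 - t) * B (\<sigma> t) = r t) (nhds t0)"
    and D: "t0 * p + (1 - t0) * q \<noteq> 0"
  shows "DERIV \<sigma> t0 :> (r' - (A (\<sigma> t0) - B (\<sigma> t0))) / (t0 * p + (1 - t0) * q)"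
proof -
  define s0 where "s0 = \<sigma> t0"
  obtain \<phi> where \<phi>: "\<And>z. A z - A s0 = \<phi> z * (z - s0)" "isCont \<phi> s0" "\<phi> s0 = p"
    using A unfolding CARAT_DERIV s0_def by blast
  obtain \<psi> where \<psi>: "\<And>z. B z - B s0 = \<psi> z * (z - s0)" "isCont \<psi> s0" "\<psi> s0 = q"
    using B unfolding CARAT_DERIV s0_def by blast
  define Q where "Q t = t * \<phi> (\<sigma> t) + (1 - t) * \<psi> (\<sigma> t)" for t
  define R where "R t = r t - t * A s0 - (1 - t) * B s0" for t
  have cont: "isCont (\<lambda>t. \<phi> (\<sigma> t)) t0" "isCont (\<lambda>t. \<psi> (\<sigma> t)) t0"
    using \<phi>(2) \<psi>(2) \<sigma> unfolding s0_def by (auto intro: isCont_o2)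
  then have Q: "isCont Q t0"
    unfolding Q_def by (intro continuous_intros)
  have Q0: "Q t0 = t0 * p + (1 - t0) * q"
    using \<phi>(3) \<psi>(3) by (simp add: Q_def s0_def)
  have "DERIV R t0 :> r' - (A s0 - B s0)"
    unfolding R_def by (auto intro!: derivative_eq_intros r)
  then obtain \<omega> where \<omega>: "\<And>t. R t - R t0 = \<omega> t * (t - t0)" "isCont \<omega> t0" "\<omega> t0 = r' - (A s0 - B s0)"
    unfolding CARAT_DERIV by blast
  have R0: "R t0 = 0"
    using eventually_nhds_x_imp_x[OF eq] by (simp add: R_def s0_def)
  have "(Q \<longlongrightarrow> Q t0) (nhds t0)"
    using Q unfolding isCont_def tendsto_at_iff_tendsto_nhds .
  then have "eventually (\<lambda>t. Q t \<noteq> 0) (nhds t0)"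
    by (rule tendsto_imp_eventually_ne) (use D Q0 in simp)
  with eq have ev: "eventually (\<lambda>t. \<sigma> t = s0 + \<omega> t / Q t * (t - t0)) (nhds t0)"
  proof eventually_elim
    case (elim t)
    have "R t = t * (A (\<sigma> t) - A s0) + (1 - t) * (B (\<sigma> t) - B s0)"
      unfolding R_def elim(1)[symmetric] by (simp add: algebra_simps)
    also have "\<dots> = Q t * (\<sigma> t - s0)"
      unfolding \<phi>(1) \<psi>(1) Q_def by (simp add: algebra_simps)
    finally have "Q t * (\<sigma> t - s0) = \<omega> t * (t - t0)"
      using \<omega>(1)[of t] R0 by simp
    then show ?case using elim(2) by (simp add: field_simps)
  qed
  have "isCont (\<lambda>t. \<omega> t / Q t) t0"
    using \<omega>(2) Q D Q0 by (intro continuous_intros) auto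
  then have "DERIV (\<lambda>t. s0 + \<omega> t / Q t * (t - t0)) t0 :> \<omega> t0 / Q t0"
    unfolding CARAT_DERIV by (intro exI[of _ "\<lambda>t. \<omega> t / Q t"]) auto
  then show ?thesis
    using DERIV_cong_ev[OF refl ev refl] \<omega>(3) Q0 by (simp add: s0_def)
qed

section \<open>The generalized Forchheimer polynomial\<close>

locale forchheimer_exponents =
  fixes N :: nat and \<alpha> :: "nat \<Rightarrow> real"
  assumes N_ge_1: "N \<ge> 1" and alpha_0: "\<alpha> 0 = 0" and alpha_mono: "strict_mono_on {0..N} \<alpha>"
begin

text \<open>The derivative of \<open>s * gfun N \<alpha> s a\<close> with respect to \<open>s\<close>.\<close>

definition dflux :: "real \<Rightarrow> (nat \<Rightarrow> real) \<Rightarrow> real" where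
  "dflux s a = (\<Sum>i=0..N. (1 + \<alpha> i) * a i * rpow s (\<alpha> i))"

lemma alpha_nonneg: "i \<le> N \<Longrightarrow> 0 \<le> \<alpha> i"
  using strict_mono_onD[OF alpha_mono, of 0 i] alpha_0 by (cases "i = 0") auto

lemma alpha_le: "i \<le> N \<Longrightarrow> \<alpha> i \<le> \<alpha> N"
  using strict_mono_onD[OF alpha_mono, of i N] by (cases "i = N") auto

lemma alpha_N_pos: "0 < \<alpha> N"
  using strict_mono_onD[OF alpha_mono, of 0 N] alpha_0 N_ge_1 by auto

lemma coeff_nonneg: "a \<in> coeff_set N \<Longrightarrow> i \<le> N \<Longrightarrow> 0 \<le> a i"
  by (cases "i = 0"; cases "i = N") (auto simp: coeff_set_def)

lemma rpow_nonneg: "0 \<le> rpow s p"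
  by (simp add: rpow_def)

lemma rpow_alpha_le:
  assumes "0 \<le> s" "i \<le> N"
  shows "rpow s (\<alpha> i) \<le> 1 + rpow s (\<alpha> N)"
proof (cases "s \<le> 1")
  case True
  then have "s powr \<alpha> i \<le> 1"
    using assms alpha_nonneg by (simp add: powr_le1)
  then show ?thesis
    using rpow_nonneg[of s "\<alpha> N"] by (auto simp: rpow_def)
next
  case False
  then have "s powr \<alpha> i \<le> s powr \<alpha> N"
    using alpha_le assms by (intro powr_mono) auto
  then show ?thesis
    using rpow_nonneg[of s "\<alpha> N"] alpha_N_pos by (auto simp: rpow_def)
qed

lemma gfun_mono:
  assumes "a \<in> coeff_set N" "0 \<le> s" "s \<le> t"
  shows "gfun N \<alpha> s a \<le> gfun N \<alpha> t a"
  unfolding gfun_def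
  by (intro sum_mono mult_left_mono)
    (use assms coeff_nonneg alpha_nonneg in \<open>auto simp: rpow_def intro: powr_mono2\<close>)

lemma gfun_ge_coeff_0:
  assumes "a \<in> coeff_set N"
  shows "a 0 \<le> gfun N \<alpha> s a"
proof -
  have "a 0 * rpow s (\<alpha> 0) \<le> gfun N \<alpha> s a"
    unfolding gfun_def
    by (rule member_le_sum) (use assms in \<open>auto simp: rpow_nonneg coeff_nonneg\<close>)
  then show ?thesis by (simp add: rpow_def alpha_0)
qed

lemma gfun_pos: "a \<in> coeff_set N \<Longrightarrow> 0 < gfun N \<alpha> s a"
  using gfun_ge_coeff_0[of a s] by (auto simp: coeff_set_def)

lemma gfun_le_dflux:
  assumes "a \<in> coeff_set N"
  shows "gfun N \<alpha> s a \<le> dflux s a"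
  unfolding gfun_def dflux_def
proof (rule sum_mono)
  fix i assume "i \<in> {0..N}"
  then have "1 * (a i * rpow s (\<alpha> i)) \<le> (1 + \<alpha> i) * (a i * rpow s (\<alpha> i))"
    using alpha_nonneg coeff_nonneg[OF assms] by (intro mult_right_mono) (auto simp: rpow_nonneg)
  then show "a i * rpow s (\<alpha> i) \<le> (1 + \<alpha> i) * a i * rpow s (\<alpha> i)"
    by (simp add: mult.assoc)
qed

lemma dflux_le_gfun:
  assumes "a \<in> coeff_set N"
  shows "dflux s a \<le> (1 + \<alpha> N) * gfun N \<alpha> s a"
  unfolding gfun_def dflux_def sum_distrib_left mult.assoc
  using alpha_le coeff_nonneg[OF assms] by (intro sum_mono mult_right_mono) (auto simp: rpow_nonneg)

lemma dflux_pos: "a \<in> coeff_set N \<Longrightarrow> 0 < dflux s a"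
  using gfun_le_dflux gfun_pos by (meson less_le_trans)

lemma dflux_ge_ends:
  assumes "a \<in> coeff_set N"
  shows "a 0 + (1 + \<alpha> N) * a N * rpow s (\<alpha> N) \<le> dflux s a"
proof -
  have "(\<Sum>i\<in>{0,N}. (1 + \<alpha> i) * a i * rpow s (\<alpha> i)) \<le> dflux s a"
    unfolding dflux_def using coeff_nonneg[OF assms] alpha_nonneg
    by (intro sum_mono2) (auto simp: rpow_nonneg)
  then show ?thesis
    using N_ge_1 by (simp add: alpha_0 rpow_def)
qed

lemma DERIV_flux:
  assumes "0 < s"
  shows "DERIV (\<lambda>s. s * gfun N \<alpha> s a) s :> dflux s a"
proof -
  have "DERIV (\<lambda>s. \<Sum>i=0..N. a i * s powr (1 + \<alpha> i)) s :> (\<Sum>i=0..N. a i * ((1 + \<alpha> i) * s powr \<alpha> i))"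
    using assms by (intro DERIV_sum DERIV_cmult) (auto intro!: derivative_eq_intros)
  moreover have "(\<Sum>i=0..N. a i * ((1 + \<alpha> i) * s powr \<alpha> i)) = dflux s a"
    using assms unfolding dflux_def by (intro sum.cong) (auto simp: rpow_def)
  moreover have "eventually (\<lambda>x. 0 < x) (nhds s)"
    using assms by (rule order_tendstoD[OF filterlim_ident])
  then have "eventually (\<lambda>x. x * gfun N \<alpha> x a = (\<Sum>i=0..N. a i * x powr (1 + \<alpha> i))) (nhds s)"
    by eventually_elim
      (auto simp: gfun_def sum_distrib_left rpow_def powr_add intro!: sum.cong)
  ultimately show ?thesis
    using DERIV_cong_ev by force
qed

text \<open>The two end terms together make up one copy of \<open>1 + rpow s (\<alpha> N)\<close>, and each of the \<open>N - 1\<close> others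
  is at most another copy. This is why the constant in \<^const>\<open>d0\<close> is \<open>N\<close> and not \<open>N + 1\<close>.\<close>

lemma sum_rpow_le:
  assumes "0 \<le> s"
  shows "(\<Sum>i=0..N. rpow s (\<alpha> i)) \<le> real N * (1 + rpow s (\<alpha> N))"
proof -
  have "{0..N} = insert 0 (insert N {1..<N})"
    using N_ge_1 by auto
  then have "(\<Sum>i=0..N. rpow s (\<alpha> i)) = 1 + rpow s (\<alpha> N) + (\<Sum>i\<in>{1..<N}. rpow s (\<alpha> i))"
    using N_ge_1 by (simp add: alpha_0 rpow_def)
  also have "(\<Sum>i\<in>{1..<N}. rpow s (\<alpha> i)) \<le> (\<Sum>i\<in>{1..<N}. 1 + rpow s (\<alpha> N))"
    using assms by (intro sum_mono rpow_alpha_le) auto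
  also have "1 + rpow s (\<alpha> N) + \<dots> = real N * (1 + rpow s (\<alpha> N))"
    using N_ge_1 by (simp add: of_nat_diff algebra_simps)
  finally show ?thesis by simp
qed

lemma gfun_diff_le:
  assumes "0 \<le> s"
  shows "\<bar>gfun N \<alpha> s a - gfun N \<alpha> s a'\<bar> \<le> coeff_dist N a a' * (real N * (1 + rpow s (\<alpha> N)))"
proof -
  have le: "\<bar>a i - a' i\<bar> \<le> coeff_dist N a a'" if "i \<in> {0..N}" for i
    using member_le_L2_set[OF finite_atLeastAtMost that, of "\<lambda>i. \<bar>a i - a' i\<bar>"]
    by (simp add: coeff_dist_def L2_set_def)
  have "gfun N \<alpha> s a - gfun N \<alpha> s a' = (\<Sum>i=0..N. (a i - a' i) * rpow s (\<alpha> i))"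
    by (simp add: gfun_def sum_subtractf left_diff_distrib)
  then have "\<bar>gfun N \<alpha> s a - gfun N \<alpha> s a'\<bar> \<le> (\<Sum>i=0..N. \<bar>(a i - a' i) * rpow s (\<alpha> i)\<bar>)"
    by simp
  also have "\<dots> \<le> (\<Sum>i=0..N. coeff_dist N a a' * rpow s (\<alpha> i))"
    using le by (intro sum_mono) (auto simp: abs_mult rpow_nonneg intro!: mult_right_mono)
  also have "\<dots> \<le> coeff_dist N a a' * (real N * (1 + rpow s (\<alpha> N)))"
    unfolding sum_distrib_left[symmetric]
    by (intro mult_left_mono sum_rpow_le assms) (simp add: coeff_dist_def)
  finally show ?thesis .
qed

section \<open>The inverse function and the conductivity\<close>

lemma sfun_nonneg_and_eq:
  assumes "a \<in> coeff_set N" "0 \<le> \<xi>"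
  shows "0 \<le> sfun N \<alpha> \<xi> a" "sfun N \<alpha> \<xi> a * gfun N \<alpha> (sfun N \<alpha> \<xi> a) a = \<xi>"
  using theI'[OF sfun_unique_exists[OF N_ge_1 alpha_0 alpha_mono assms]]
  unfolding sfun_def by auto

lemma sfun_pos: "a \<in> coeff_set N \<Longrightarrow> 0 < \<xi> \<Longrightarrow> 0 < sfun N \<alpha> \<xi> a"
  using sfun_nonneg_and_eq[of a \<xi>] by (cases "sfun N \<alpha> \<xi> a = 0") auto

lemma Kfun_nonneg: "a \<in> coeff_set N \<Longrightarrow> 0 \<le> Kfun N \<alpha> \<xi> a"
  unfolding Kfun_def using gfun_pos[of a] by (simp add: less_imp_le)

lemma Kfun_times_eq_sfun:
  assumes "a \<in> coeff_set N" "0 \<le> \<xi>"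
  shows "Kfun N \<alpha> \<xi> a * \<xi> = sfun N \<alpha> \<xi> a"
  using sfun_nonneg_and_eq(2)[OF assms] gfun_pos[OF assms(1), of "sfun N \<alpha> \<xi> a"]
  unfolding Kfun_def by (simp add: field_simps)

text \<open>Since \<open>s \<mapsto> s * gfun N \<alpha> s a\<close> grows at rate at least \<open>a 0\<close>, any \<open>s\<close> that nearly solves the
  equation is close to the solution; this gives joint continuity in \<open>\<xi>\<close> and \<open>a\<close>.\<close>

lemma sfun_error_le_residual:
  assumes a: "a \<in> coeff_set N" and "0 \<le> \<xi>" "0 \<le> s"
  shows "a 0 * \<bar>sfun N \<alpha> \<xi> a - s\<bar> \<le> \<bar>\<xi> - s * gfun N \<alpha> s a\<bar>"
proof -
  have *: "a 0 * (t - s) \<le> t * gfun N \<alpha> t a - s * gfun N \<alpha> s a" if "0 \<le> s" "s \<le> t" for s t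
  proof -
    have "a 0 * (t - s) \<le> gfun N \<alpha> t a * (t - s)"
      using that gfun_ge_coeff_0[OF a] by (intro mult_right_mono) auto
    also have "\<dots> \<le> t * gfun N \<alpha> t a - s * gfun N \<alpha> s a"
      using mult_left_mono[OF gfun_mono[OF a that] that(1)] by (simp add: algebra_simps)
    finally show ?thesis .
  qed
  show ?thesis
    using *[of s "sfun N \<alpha> \<xi> a"] *[of "sfun N \<alpha> \<xi> a" s] sfun_nonneg_and_eq[OF a \<open>0 \<le> \<xi>\<close>] \<open>0 \<le> s\<close>
    by (cases "s \<le> sfun N \<alpha> \<xi> a") (auto simp: algebra_simps)
qed

lemma seg_coeff_in_coeff_set:
  assumes "a \<in> coeff_set N" "a' \<in> coeff_set N" "0 \<le> t" "t \<le> 1"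
  shows "seg_coeff a a' t \<in> coeff_set N"
proof -
  have pos: "0 < t * x + (1 - t) * x'" if "0 < x" "0 < x'" for x x' :: real
    using that assms(3,4) by (cases "t = 0") (auto intro!: add_pos_nonneg)
  show ?thesis
    using assms by (auto simp: coeff_set_def seg_coeff_def intro!: pos add_nonneg_nonneg mult_nonneg_nonneg)
qed

lemma gfun_seg_coeff:
  "gfun N \<alpha> s (seg_coeff a a' t) = t * gfun N \<alpha> s a + (1 - t) * gfun N \<alpha> s a'"
proof -
  have "gfun N \<alpha> s (seg_coeff a a' t)
      = (\<Sum>i=0..N. t * (a i * rpow s (\<alpha> i)) + (1 - t) * (a' i * rpow s (\<alpha> i)))"
    unfolding gfun_def seg_coeff_def by (intro sum.cong refl) algebra
  then show ?thesis
    by (simp only: gfun_def sum.distrib sum_distrib_left)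
qed

lemma dflux_seg_coeff:
  "dflux s (seg_coeff a a' t) = t * dflux s a + (1 - t) * dflux s a'"
proof -
  have "dflux s (seg_coeff a a' t)
      = (\<Sum>i=0..N. t * ((1 + \<alpha> i) * a i * rpow s (\<alpha> i)) + (1 - t) * ((1 + \<alpha> i) * a' i * rpow s (\<alpha> i)))"
    unfolding dflux_def seg_coeff_def by (intro sum.cong refl) algebra
  then show ?thesis
    by (simp only: dflux_def sum.distrib sum_distrib_left)
qed

lemma continuous_on_sfun_seg:
  assumes a: "a \<in> coeff_set N" "a' \<in> coeff_set N"
    and r: "continuous_on {0..1} r" "\<And>t. t \<in> {0..1} \<Longrightarrow> 0 \<le> r t"
  shows "continuous_on {0..1} (\<lambda>t. sfun N \<alpha> (r t) (seg_coeff a a' t))"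
  unfolding continuous_on_def
proof
  fix t0 :: real assume t0: "t0 \<in> {0..1}"
  define m where "m = min (a 0) (a' 0)"
  have m: "0 < m" using a by (auto simp: m_def coeff_set_def)
  define \<sigma> where "\<sigma> t = sfun N \<alpha> (r t) (seg_coeff a a' t)" for t
  define e where "e t = \<bar>r t - \<sigma> t0 * gfun N \<alpha> (\<sigma> t0) (seg_coeff a a' t)\<bar> / m" for t
  have s0: "0 \<le> \<sigma> t0" "\<sigma> t0 * gfun N \<alpha> (\<sigma> t0) (seg_coeff a a' t0) = r t0"
    using sfun_nonneg_and_eq[OF seg_coeff_in_coeff_set[OF a]] r(2) t0 by (auto simp: \<sigma>_def)
  have "continuous_on {0..1} e"
    unfolding e_def gfun_seg_coeff using m by (intro continuous_intros r(1)) auto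
  then have "(e \<longlongrightarrow> 0) (at t0 within {0..1})"
    using t0 s0(2) unfolding continuous_on_def by (force simp: e_def[of t0])
  moreover have "eventually (\<lambda>t. norm (\<sigma> t - \<sigma> t0) \<le> e t) (at t0 within {0..1})"
    unfolding eventually_at_topological
  proof (intro exI[of _ UNIV] conjI ballI impI)
    fix t :: real assume t: "t \<in> {0..1}"
    have "m * 1 = t * m + (1 - t) * m" by (simp add: algebra_simps)
    also have "\<dots> \<le> seg_coeff a a' t 0"
      using t by (auto simp: seg_coeff_def m_def intro!: add_mono mult_left_mono)
    finally have "m * \<bar>\<sigma> t - \<sigma> t0\<bar> \<le> seg_coeff a a' t 0 * \<bar>\<sigma> t - \<sigma> t0\<bar>"
      by (intro mult_right_mono) auto
    also have "\<dots> \<le> \<bar>r t - \<sigma> t0 * gfun N \<alpha> (\<sigma> t0) (seg_coeff a a' t)\<bar>"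
      unfolding \<sigma>_def[of t]
      by (rule sfun_error_le_residual) (use seg_coeff_in_coeff_set[OF a] r(2) t s0 in auto)
    finally show "norm (\<sigma> t - \<sigma> t0) \<le> e t"
      using m by (simp add: e_def field_simps)
  qed auto
  ultimately have "((\<lambda>t. \<sigma> t - \<sigma> t0) \<longlongrightarrow> 0) (at t0 within {0..1})"
    by (rule Lim_null_comparison[rotated])
  then show "((\<lambda>t. sfun N \<alpha> (r t) (seg_coeff a a' t)) \<longlongrightarrow> sfun N \<alpha> (r t0) (seg_coeff a a' t0)) (at t0 within {0..1})"
    by (simp add: \<sigma>_def LIM_zero_iff)
qed

lemma continuous_on_Kfun_seg:
  assumes a: "a \<in> coeff_set N" "a' \<in> coeff_set N"
    and r: "continuous_on {0..1} r" "\<And>t. t \<in> {0..1} \<Longrightarrow> 0 \<le> r t"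
  shows "continuous_on {0..1} (\<lambda>t. Kfun N \<alpha> (r t) (seg_coeff a a' t))"
proof -
  define \<sigma> where "\<sigma> t = sfun N \<alpha> (r t) (seg_coeff a a' t)" for t
  have \<sigma>: "continuous_on {0..1} \<sigma>"
    unfolding \<sigma>_def by (rule continuous_on_sfun_seg[OF assms])
  have g: "continuous_on {0..1} (\<lambda>t. gfun N \<alpha> (\<sigma> t) c)" for c
    by (rule continuous_on_compose2[OF gfun_continuous_on[of N \<alpha>] \<sigma>])
      (use alpha_nonneg sfun_nonneg_and_eq(1)[OF seg_coeff_in_coeff_set[OF a]] r(2) in \<open>auto simp: \<sigma>_def\<close>)
  have "gfun N \<alpha> (\<sigma> t) (seg_coeff a a' t) \<noteq> 0" if "t \<in> {0..1}" for t
    using gfun_pos[OF seg_coeff_in_coeff_set[OF a]] that by (metis atLeastAtMost_iff less_irrefl)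
  then show ?thesis
    unfolding Kfun_def \<sigma>_def[symmetric]
    by (intro continuous_on_divide continuous_on_const) (auto simp: gfun_seg_coeff intro!: continuous_intros g)
qed

lemma Kfun_cong:
  assumes "\<And>i. i \<le> N \<Longrightarrow> a i = a' i"
  shows "Kfun N \<alpha> \<xi> a = Kfun N \<alpha> \<xi> a'"
proof -
  have "gfun N \<alpha> s a = gfun N \<alpha> s a'" for s
    unfolding gfun_def using assms by (intro sum.cong) auto
  then show ?thesis unfolding Kfun_def sfun_def by (simp only:)
qed

section \<open>The derivative along the segment\<close>

text \<open>In polar form the flux \<open>K \<gamma>\<close> is \<open>\<sigma> sgn \<gamma>\<close>, and implicit differentiation gives
  \<open>\<sigma>' = (\<rho>' - \<sigma> c) / D\<close>; splitting off \<open>K v\<close>, where \<open>v = y - y'\<close> is the derivative of \<open>\<gamma>\<close>, leaves only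
  a multiple of the unit vector \<open>sgn \<gamma>\<close>. Since \<open>sgn 0 = 0\<close>, the formula still satisfies the two
  estimates where \<open>\<gamma>\<close> vanishes.\<close>

definition flux_velocity ::
  "(nat \<Rightarrow> real) \<Rightarrow> (nat \<Rightarrow> real) \<Rightarrow> 'v::euclidean_space \<Rightarrow> 'v \<Rightarrow> real \<Rightarrow> 'v" where
  "flux_velocity a a' y y' t =
     (let b = seg_coeff a a' t; u = sgn (seg_pt y y' t); v = y - y';
          \<xi> = norm (seg_pt y y' t); s = sfun N \<alpha> \<xi> b; K = Kfun N \<alpha> \<xi> b; D = dflux s b;
          c = gfun N \<alpha> s a - gfun N \<alpha> s a'
      in K *\<^sub>R v + ((1 / D - K) * (u \<bullet> v) - s * c / D) *\<^sub>R u)"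

lemma continuous_on_seg_pt: "continuous_on A (\<lambda>t. seg_pt y y' t :: 'v::real_normed_vector)"
  unfolding seg_pt_def by (intro continuous_intros)

lemma flux_has_vector_derivative:
  fixes y y' :: "'v::euclidean_space"
  assumes a: "a \<in> coeff_set N" "a' \<in> coeff_set N"
    and t0: "0 < t0" "t0 < 1" and nz: "seg_pt y y' t0 \<noteq> 0"
  shows "((\<lambda>t. Kfun N \<alpha> (norm (seg_pt y y' t)) (seg_coeff a a' t) *\<^sub>R seg_pt y y' t)
          has_vector_derivative flux_velocity a a' y y' t0) (at t0)"
proof -
  define b where "b t = seg_coeff a a' t" for t
  define \<gamma> where "\<gamma> t = seg_pt y y' t" for t
  define r where "r t = norm (\<gamma> t)" for t
  define \<sigma> where "\<sigma> t = sfun N \<alpha> (r t) (b t)" for t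
  define D where "D = dflux (\<sigma> t0) (b t0)"
  define c where "c = gfun N \<alpha> (\<sigma> t0) a - gfun N \<alpha> (\<sigma> t0) a'"
  define r' where "r' = sgn (\<gamma> t0) \<bullet> (y - y')"
  have b: "b t \<in> coeff_set N" if "t \<in> {0..1}" for t
    using seg_coeff_in_coeff_set[OF a] that by (simp add: b_def)
  have rpos: "0 < r t0"
    using nz by (simp add: r_def \<gamma>_def)
  have spos: "0 < \<sigma> t0"
    using sfun_pos[OF b rpos] t0 by (simp add: \<sigma>_def)
  have Dpos: "0 < D"
    unfolding D_def using t0 by (intro dflux_pos b) auto
  have \<gamma>': "(\<gamma> has_vector_derivative (y - y')) (at t0)"
    unfolding \<gamma>_def seg_pt_def by (auto intro!: derivative_eq_intros)
  have "((\<lambda>t. norm (\<gamma> t)) has_derivative (\<lambda>h. (h *\<^sub>R (y - y')) \<bullet> sgn (\<gamma> t0))) (at t0)"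
    using \<gamma>' nz unfolding has_vector_derivative_def
    by (intro has_derivative_compose[where g=norm, OF _ has_derivative_norm]) (auto simp: \<gamma>_def[symmetric])
  then have r': "DERIV r t0 :> r'"
    unfolding has_field_derivative_def r_def[abs_def] r'_def
    by (rule has_derivative_eq_rhs) (auto simp: inner_commute)
  have contr: "continuous_on {0..1} r"
    unfolding r_def \<gamma>_def by (intro continuous_intros continuous_on_seg_pt)
  have "isCont \<sigma> t0"
    using continuous_on_sfun_seg[OF a contr] t0
    by (intro continuous_on_interior[of "{0..1}"]) (auto simp: \<sigma>_def b_def r_def)
  moreover have "eventually (\<lambda>t. t \<in> {0<..<1}) (nhds t0)"
    using t0 by (intro eventually_nhds_in_open) auto
  then have "eventually (\<lambda>t. t * (\<sigma> t * gfun N \<alpha> (\<sigma> t) a) + (1 - t) * (\<sigma> t * gfun N \<alpha> (\<sigma> t) a') = r t) (nhds t0)"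
  proof eventually_elim
    case (elim t)
    then have "\<sigma> t * gfun N \<alpha> (\<sigma> t) (b t) = r t"
      unfolding \<sigma>_def by (intro sfun_nonneg_and_eq b) (auto simp: r_def)
    then show ?case
      by (simp add: b_def gfun_seg_coeff algebra_simps)
  qed
  moreover have D: "D = t0 * dflux (\<sigma> t0) a + (1 - t0) * dflux (\<sigma> t0) a'"
    by (simp add: D_def b_def dflux_seg_coeff)
  ultimately have "DERIV \<sigma> t0 :> (r' - (\<sigma> t0 * gfun N \<alpha> (\<sigma> t0) a - \<sigma> t0 * gfun N \<alpha> (\<sigma> t0) a')) / D"
    unfolding D by (intro DERIV_implicit_interpolation[OF _ DERIV_flux DERIV_flux r'])
      (use spos Dpos D in auto)
  then have \<sigma>': "DERIV \<sigma> t0 :> (r' - \<sigma> t0 * c) / D"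
    by (simp add: c_def right_diff_distrib)
  \<comment> \<open>The quotient form agrees with the flux on the whole open interval, as both vanish with \<open>\<gamma>\<close>.\<close>
  have "((\<lambda>t. (\<sigma> t / r t) *\<^sub>R \<gamma> t) has_vector_derivative
      (\<sigma> t0 / r t0) *\<^sub>R (y - y') + (((r' - \<sigma> t0 * c) / D * r t0 - \<sigma> t0 * r') / (r t0 * r t0)) *\<^sub>R \<gamma> t0) (at t0)"
    using rpos by (intro has_vector_derivative_scaleR DERIV_divide \<sigma>' r' \<gamma>') auto
  moreover have K: "(\<sigma> t / r t) *\<^sub>R \<gamma> t = Kfun N \<alpha> (r t) (b t) *\<^sub>R \<gamma> t" if "t \<in> {0<..<1}" for t
    using Kfun_times_eq_sfun[OF b, of t "r t"] that
    by (cases "\<gamma> t = 0") (auto simp: \<sigma>_def r_def field_simps)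
  ultimately have "((\<lambda>t. Kfun N \<alpha> (r t) (b t) *\<^sub>R \<gamma> t) has_vector_derivative
      (\<sigma> t0 / r t0) *\<^sub>R (y - y') + (((r' - \<sigma> t0 * c) / D * r t0 - \<sigma> t0 * r') / (r t0 * r t0)) *\<^sub>R \<gamma> t0) (at t0)"
    using t0 by (elim has_vector_derivative_transform_within_open[where S="{0<..<1}"]) auto
  moreover have "\<sigma> t0 = Kfun N \<alpha> (r t0) (b t0) * r t0"
    using Kfun_times_eq_sfun[OF b, of t0 "r t0"] t0 rpos by (simp add: \<sigma>_def)
  then have "(\<sigma> t0 / r t0) *\<^sub>R (y - y') + (((r' - \<sigma> t0 * c) / D * r t0 - \<sigma> t0 * r') / (r t0 * r t0)) *\<^sub>R \<gamma> t0
    = Kfun N \<alpha> (r t0) (b t0) *\<^sub>R (y - y')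
      + ((1 / D - Kfun N \<alpha> (r t0) (b t0)) * r' - \<sigma> t0 * c / D) *\<^sub>R (\<gamma> t0 /\<^sub>R r t0)"
    using rpos Dpos by (simp add: field_simps)
  ultimately show ?thesis
    by (simp add: flux_velocity_def Let_def r'_def c_def D_def \<sigma>_def r_def \<gamma>_def b_def sgn_div_norm)
qed

text \<open>The difference \<open>1 / D - K\<close> is \<open>\<xi>\<close> times the derivative of \<open>K\<close> in \<open>\<xi>\<close>, so this is the degeneracy
  bound for \<open>K\<close>. It holds because every term of \<open>s * gfun N \<alpha> s b\<close> is a nonnegative multiple of a power of
  \<open>s\<close> with exponent between \<open>1\<close> and \<open>1 + \<alpha> N = 1 / (1 - deg_exp N \<alpha>)\<close>, so that \<open>D\<close> lies between \<open>1 / K\<close> and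
  \<open>1 + \<alpha> N\<close> times \<open>1 / K\<close>.\<close>

lemma inverse_dflux_bounds:
  assumes b: "b \<in> coeff_set N" and s: "s = sfun N \<alpha> \<xi> b"
  shows "1 / dflux s b \<le> Kfun N \<alpha> \<xi> b" "(1 - deg_exp N \<alpha>) * Kfun N \<alpha> \<xi> b \<le> 1 / dflux s b"
proof -
  show "1 / dflux s b \<le> Kfun N \<alpha> \<xi> b"
    unfolding Kfun_def s[symmetric]
    using gfun_le_dflux[OF b, of s] gfun_pos[OF b, of s] by (simp add: frac_le)
  have "1 - deg_exp N \<alpha> = 1 / (1 + \<alpha> N)"
    using alpha_N_pos by (simp add: deg_exp_def field_simps)
  then have "(1 - deg_exp N \<alpha>) * Kfun N \<alpha> \<xi> b = 1 / ((1 + \<alpha> N) * gfun N \<alpha> s b)"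
    by (simp add: Kfun_def s)
  also have "\<dots> \<le> 1 / dflux s b"
    using dflux_le_gfun[OF b, of s] dflux_pos[OF b, of s] by (simp add: frac_le)
  finally show "(1 - deg_exp N \<alpha>) * Kfun N \<alpha> \<xi> b \<le> 1 / dflux s b" .
qed

text \<open>The minimum \<open>m\<close> in \<^const>\<open>d0\<close> bounds the end coefficients of \<open>a\<close> and \<open>a'\<close>, so the end terms of
  \<open>dflux\<close> alone exceed \<open>m * (1 + rpow s (\<alpha> N))\<close>. This bound is stable under interpolation since
  \<open>dflux\<close> is linear in the coefficients, and the last factor cancels against the one in the numerator.\<close>

lemma gfun_diff_le_dflux:
  assumes a: "a \<in> coeff_set N" "a' \<in> coeff_set N" and t: "t \<in> {0..1}" and s: "0 \<le> s"
  shows "\<bar>gfun N \<alpha> s a - gfun N \<alpha> s a'\<bar> / dflux s (seg_coeff a a' t) \<le> d0 N \<alpha> a a' * coeff_dist N a a'"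
proof -
  define m where "m = Min {a 0, a' 0, (1 + \<alpha> N) * a N, (1 + \<alpha> N) * a' N}"
  define p where "p = 1 + rpow s (\<alpha> N)"
  have m: "0 < m" "m \<le> a 0" "m \<le> a' 0" "m \<le> (1 + \<alpha> N) * a N" "m \<le> (1 + \<alpha> N) * a' N"
    using a alpha_N_pos by (auto simp: m_def coeff_set_def)
  have p: "0 < p"
    using rpow_nonneg[of s "\<alpha> N"] by (simp add: p_def)
  have mp: "m * p \<le> dflux s x" if x: "x \<in> coeff_set N" "m \<le> x 0" "m \<le> (1 + \<alpha> N) * x N" for x
  proof -
    have "m * p \<le> x 0 + (1 + \<alpha> N) * x N * rpow s (\<alpha> N)"
      using x(2) mult_right_mono[OF x(3) rpow_nonneg[of s "\<alpha> N"]] by (simp add: p_def algebra_simps)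
    also have "\<dots> \<le> dflux s x"
      by (rule dflux_ge_ends[OF x(1)])
    finally show ?thesis .
  qed
  have "m * p = t * (m * p) + (1 - t) * (m * p)"
    by (simp add: algebra_simps)
  also have "\<dots> \<le> dflux s (seg_coeff a a' t)"
    unfolding dflux_seg_coeff using t m a by (intro add_mono mult_left_mono mp) auto
  finally have "\<bar>gfun N \<alpha> s a - gfun N \<alpha> s a'\<bar> / dflux s (seg_coeff a a' t)
      \<le> coeff_dist N a a' * (real N * p) / (m * p)"
    using gfun_diff_le[OF s, of a a'] m p by (intro frac_le) (auto simp: p_def coeff_dist_def)
  also have "\<dots> = d0 N \<alpha> a a' * coeff_dist N a a'"
    unfolding d0_def m_def[symmetric] using p by (simp add: field_simps)
  finally show ?thesis .
qed

text \<open>The radial coefficient has absolute value at most \<open>\<theta> * K * norm v + \<delta>\<close>; both estimates follow from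
  this and Cauchy-Schwarz.\<close>

lemma perturbed_multiple_bounds:
  fixes u v :: "'v::real_inner"
  assumes u: "norm u \<le> 1" and q: "q \<le> K" "(1 - \<theta>) * K \<le> q" and w: "\<bar>w\<bar> \<le> \<delta>" and K: "0 \<le> K"
  defines "H \<equiv> K *\<^sub>R v + ((q - K) * (u \<bullet> v) - w) *\<^sub>R u"
  shows "norm H \<le> (1 + \<theta>) * norm v * K + \<delta>"
    and "(1 - \<theta>) * (norm v)\<^sup>2 * K - \<delta> * norm v \<le> H \<bullet> v"
proof -
  have uv: "\<bar>u \<bullet> v\<bar> \<le> norm v"
    using Cauchy_Schwarz_ineq2[of u v] mult_right_mono[OF u norm_ge_zero[of v]] by simp
  have "\<bar>(q - K) * (u \<bullet> v)\<bar> \<le> (\<theta> * K) * norm v"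
    unfolding abs_mult using q uv by (intro mult_mono) (auto simp: algebra_simps)
  then have coef: "\<bar>(q - K) * (u \<bullet> v) - w\<bar> \<le> \<theta> * K * norm v + \<delta>"
    using w by linarith
  have "norm H \<le> K * norm v + \<bar>(q - K) * (u \<bullet> v) - w\<bar> * norm u"
    unfolding H_def using K by (intro norm_triangle_le) simp
  also have "\<dots> \<le> K * norm v + (\<theta> * K * norm v + \<delta>)"
    using mult_mono[OF coef u] coef by simp
  finally show "norm H \<le> (1 + \<theta>) * norm v * K + \<delta>"
    by (simp add: algebra_simps)
  have "\<bar>((q - K) * (u \<bullet> v) - w) * (u \<bullet> v)\<bar> \<le> (\<theta> * K * norm v + \<delta>) * norm v"
    unfolding abs_mult using coef uv by (intro mult_mono) auto
  moreover have "H \<bullet> v = K * (norm v)\<^sup>2 + ((q - K) * (u \<bullet> v) - w) * (u \<bullet> v)"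
    by (simp add: H_def inner_add_left power2_norm_eq_inner)
  ultimately show "(1 - \<theta>) * (norm v)\<^sup>2 * K - \<delta> * norm v \<le> H \<bullet> v"
    by (simp add: algebra_simps power2_eq_square)
qed

lemma flux_velocity_bounds:
  fixes y y' :: "'v::euclidean_space"
  assumes a: "a \<in> coeff_set N" "a' \<in> coeff_set N" and t: "t \<in> {0..1}"
  defines "K \<equiv> Kfun N \<alpha> (norm (seg_pt y y' t)) (seg_coeff a a' t)"
    and "\<Delta> \<equiv> d0 N \<alpha> a a' * max (norm y) (norm y') * coeff_dist N a a'"
  shows "norm (flux_velocity a a' y y' t) \<le> ((1 + deg_exp N \<alpha>) * norm (y - y') + \<Delta>) * K"
    and "((1 - deg_exp N \<alpha>) * (norm (y - y'))\<^sup>2 - \<Delta> * norm (y - y')) * K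
           \<le> flux_velocity a a' y y' t \<bullet> (y - y')"
proof -
  define b where "b = seg_coeff a a' t"
  define \<xi> where "\<xi> = norm (seg_pt y y' t)"
  define s where "s = sfun N \<alpha> \<xi> b"
  define c where "c = gfun N \<alpha> s a - gfun N \<alpha> s a'"
  define D where "D = dflux s b"
  have b: "b \<in> coeff_set N"
    using seg_coeff_in_coeff_set[OF a] t by (simp add: b_def)
  have K: "K = Kfun N \<alpha> \<xi> b"
    by (simp add: K_def \<xi>_def b_def)
  have K0: "0 \<le> K"
    unfolding K by (rule Kfun_nonneg[OF b])
  have s0: "0 \<le> s" and sK: "s = \<xi> * K"
    using sfun_nonneg_and_eq[OF b, of \<xi>] Kfun_times_eq_sfun[OF b, of \<xi>]
    by (auto simp: s_def K \<xi>_def mult.commute)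
  have D: "0 < D" unfolding D_def by (rule dflux_pos[OF b])
  have "\<xi> \<le> t * norm y + (1 - t) * norm y'"
    unfolding \<xi>_def seg_pt_def using t by (intro norm_triangle_le) simp
  also have "\<dots> \<le> t * max (norm y) (norm y') + (1 - t) * max (norm y) (norm y')"
    using t by (intro add_mono mult_left_mono) auto
  finally have \<xi>: "\<xi> \<le> max (norm y) (norm y')"
    by (simp add: algebra_simps)
  have "0 \<le> max (norm y) (norm y') * K"
    using K0 by (intro mult_nonneg_nonneg) (simp_all add: le_max_iff_disj)
  have "\<bar>s * c / D\<bar> = (\<xi> * K) * (\<bar>c\<bar> / D)"
    using s0 D by (simp add: abs_mult flip: sK)
  also have "\<dots> \<le> (max (norm y) (norm y') * K) * (d0 N \<alpha> a a' * coeff_dist N a a')"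
    using gfun_diff_le_dflux[OF a t s0] D \<open>0 \<le> max (norm y) (norm y') * K\<close>
    by (intro mult_mono[OF mult_right_mono[OF \<xi> K0]]) (auto simp: c_def D_def b_def)
  also have "\<dots> = \<Delta> * K"
    by (simp add: \<Delta>_def)
  finally have w: "\<bar>s * c / D\<bar> \<le> \<Delta> * K" .
  have eq: "flux_velocity a a' y y' t = K *\<^sub>R (y - y')
      + ((1 / D - K) * (sgn (seg_pt y y' t) \<bullet> (y - y')) - s * c / D) *\<^sub>R sgn (seg_pt y y' t)"
    by (simp add: flux_velocity_def Let_def K_def D_def c_def s_def \<xi>_def b_def)
  have u: "norm (sgn (seg_pt y y' t)) \<le> 1"
    by (simp add: norm_sgn)
  note bounds = perturbed_multiple_bounds[OF u, of "1 / D" K "deg_exp N \<alpha>" "s * c / D" "\<Delta> * K" "y - y'",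
      folded eq]
  show "norm (flux_velocity a a' y y' t) \<le> ((1 + deg_exp N \<alpha>) * norm (y - y') + \<Delta>) * K"
    using bounds(1) inverse_dflux_bounds[OF b s_def] w K0 by (simp add: K D_def algebra_simps)
  show "((1 - deg_exp N \<alpha>) * (norm (y - y'))\<^sup>2 - \<Delta> * norm (y - y')) * K
      \<le> flux_velocity a a' y y' t \<bullet> (y - y')"
    using bounds(2) inverse_dflux_bounds[OF b s_def] w K0 by (simp add: K D_def algebra_simps)
qed

section \<open>Integration along the segment\<close>

text \<open>The flux may fail to be differentiable where the segment meets the origin; unless the segment is
  degenerate this is a single parameter, which continuity lets the fundamental theorem of calculus
  ignore.\<close>

lemma flux_velocity_has_integral:
  fixes y y' :: "'v::euclidean_space"
  assumes a: "a \<in> coeff_set N" "a' \<in> coeff_set N"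
  shows "(flux_velocity a a' y y' has_integral (Kfun N \<alpha> (norm y) a *\<^sub>R y - Kfun N \<alpha> (norm y') a' *\<^sub>R y')) {0..1}"
proof (cases "y = 0 \<and> y' = 0")
  case True
  then have "flux_velocity a a' y y' = (\<lambda>t. 0)"
    by (auto simp: flux_velocity_def seg_pt_def Let_def)
  with True show ?thesis by simp
next
  case False
  define h where "h t = Kfun N \<alpha> (norm (seg_pt y y' t)) (seg_coeff a a' t) *\<^sub>R seg_pt y y' t" for t
  have "t = t'" if "seg_pt y y' t = 0" "seg_pt y y' t' = 0" for t t'
  proof (rule ccontr)
    assume "t \<noteq> t'"
    have "(t - t') *\<^sub>R (y - y') = seg_pt y y' t - seg_pt y y' t'"
      by (simp add: seg_pt_def algebra_simps)
    with that \<open>t \<noteq> t'\<close> have "y = y'" by simp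
    with that have "y = 0" by (simp add: seg_pt_def algebra_simps)
    with \<open>y = y'\<close> False show False by simp
  qed
  then have "{t. seg_pt y y' t = 0} \<subseteq> {THE t. seg_pt y y' t = 0}"
    by (auto intro!: the_equality[symmetric])
  then have "finite {t. seg_pt y y' t = 0}"
    by (rule finite_subset) simp
  moreover have "continuous_on {0..1} h"
    unfolding h_def
    by (intro continuous_on_scaleR continuous_on_Kfun_seg[OF a] continuous_on_norm continuous_on_seg_pt) auto
  moreover have "(h has_vector_derivative flux_velocity a a' y y' t) (at t)"
    if "t \<in> {0<..<1} - {t. seg_pt y y' t = 0}" for t
    unfolding h_def using that by (intro flux_has_vector_derivative[OF a]) auto
  ultimately have "(flux_velocity a a' y y' has_integral h 1 - h 0) {0..1}"
    by (intro fundamental_theorem_of_calculus_interior_strong) auto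
  then show ?thesis
    by (simp add: h_def seg_pt_def seg_coeff_def)
qed

lemma flux_difference_bounds:
  fixes y y' :: "'v::euclidean_space"
  assumes a: "a \<in> coeff_set N" "a' \<in> coeff_set N"
  defines "I \<equiv> integral {0..1} (\<lambda>t. Kfun N \<alpha> (norm (seg_pt y y' t)) (seg_coeff a a' t))"
    and "F \<equiv> Kfun N \<alpha> (norm y) a *\<^sub>R y - Kfun N \<alpha> (norm y') a' *\<^sub>R y'"
    and "\<Delta> \<equiv> d0 N \<alpha> a a' * max (norm y) (norm y') * coeff_dist N a a'"
  shows "norm F \<le> ((1 + deg_exp N \<alpha>) * norm (y - y') + \<Delta>) * I"
    and "((1 - deg_exp N \<alpha>) * (norm (y - y'))\<^sup>2 - \<Delta> * norm (y - y')) * I \<le> F \<bullet> (y - y')"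
proof -
  have "(\<lambda>t. Kfun N \<alpha> (norm (seg_pt y y' t)) (seg_coeff a a' t)) integrable_on {0..1}"
    by (intro integrable_continuous_interval continuous_on_Kfun_seg[OF a] continuous_on_norm
        continuous_on_seg_pt) auto
  then have I: "((\<lambda>t. Kfun N \<alpha> (norm (seg_pt y y' t)) (seg_coeff a a' t)) has_integral I) {0..1}"
    unfolding I_def by (rule integrable_integral)
  have V: "(flux_velocity a a' y y' has_integral F) {0..1}"
    unfolding F_def by (rule flux_velocity_has_integral[OF a])
  note CI = has_integral_mult_right[OF I]
  show "norm F \<le> ((1 + deg_exp N \<alpha>) * norm (y - y') + \<Delta>) * I"
    unfolding integral_unique[OF V, symmetric] integral_unique[OF CI, symmetric] \<Delta>_def
    by (rule integral_norm_bound_integral[OF has_integral_integrable[OF V]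
          has_integral_integrable[OF CI[of "(1 + deg_exp N \<alpha>) * norm (y - y') + \<Delta>", unfolded \<Delta>_def]]
          flux_velocity_bounds(1)[OF a]])
  have "((\<lambda>t. flux_velocity a a' y y' t \<bullet> (y - y')) has_integral F \<bullet> (y - y')) {0..1}"
    using has_integral_linear[OF V bounded_linear_inner_left] by (simp add: o_def)
  then show "((1 - deg_exp N \<alpha>) * (norm (y - y'))\<^sup>2 - \<Delta> * norm (y - y')) * I \<le> F \<bullet> (y - y')"
    by (rule has_integral_le[OF CI]) (unfold \<Delta>_def, rule flux_velocity_bounds(2)[OF a])
qed

end

theorem lemma2p2:
  fixes N :: nat and \<alpha> a a' :: "nat \<Rightarrow> real" and y y' :: "real ^ 'd"
  assumes "CARD('d) \<ge> 2" and "N \<ge> 1"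
    and "\<alpha> 0 = 0" and "strict_mono_on {0..N} \<alpha>"
    and "a \<in> coeff_set N" and "a' \<in> coeff_set N"
  shows
    "norm (Kfun N \<alpha> (norm y) a *\<^sub>R y - Kfun N \<alpha> (norm y') a' *\<^sub>R y')
       \<le> (1 + deg_exp N \<alpha>) * norm (y - y')
             * integral {0..1} (\<lambda>t. Kfun N \<alpha> (norm (seg_pt y y' t)) (seg_coeff a a' t))
         + d0 N \<alpha> a a' * max (norm y) (norm y') * coeff_dist N a a'
             * integral {0..1} (\<lambda>t. Kfun N \<alpha> (norm (seg_pt y y' t)) (seg_coeff a a' t))
     \<and> (Kfun N \<alpha> (norm y) a *\<^sub>R y - Kfun N \<alpha> (norm y') a' *\<^sub>R y') \<bullet> (y - y')
       \<ge> (1 - deg_exp N \<alpha>) * (norm (y - y'))\<^sup>2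
             * integral {0..1} (\<lambda>t. Kfun N \<alpha> (norm (seg_pt y y' t)) (seg_coeff a a' t))
         - d0 N \<alpha> a a' * max (norm y) (norm y') * coeff_dist N a a' * norm (y - y')
             * integral {0..1} (\<lambda>t. Kfun N \<alpha> (norm (seg_pt y y' t)) (seg_coeff a a' t))
     \<and> ((\<forall>i\<le>N. a i = a' i) \<longrightarrow>
         norm (Kfun N \<alpha> (norm y') a *\<^sub>R y' - Kfun N \<alpha> (norm y) a *\<^sub>R y)
           \<le> (1 + deg_exp N \<alpha>) * norm (y' - y)
                 * integral {0..1} (\<lambda>t. Kfun N \<alpha> (norm (seg_pt y y' t)) a)
       \<and> (Kfun N \<alpha> (norm y') a *\<^sub>R y' - Kfun N \<alpha> (norm y) a *\<^sub>R y) \<bullet> (y' - y)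
           \<ge> (1 - deg_exp N \<alpha>) * (norm (y' - y))\<^sup>2
                 * integral {0..1} (\<lambda>t. Kfun N \<alpha> (norm (seg_pt y y' t)) a))"
proof -
  interpret forchheimer_exponents N \<alpha>
    using assms(2-4) by unfold_locales
  note bounds = flux_difference_bounds[OF assms(5,6), of y y']
  have equal_coeffs: "coeff_dist N a a' = 0"
      "\<And>\<xi>. Kfun N \<alpha> \<xi> a' = Kfun N \<alpha> \<xi> a"
      "\<And>\<xi> t. Kfun N \<alpha> \<xi> (seg_coeff a a' t) = Kfun N \<alpha> \<xi> a"
    if "\<forall>i\<le>N. a i = a' i"
    using that by (auto simp: coeff_dist_def L2_set_def seg_coeff_def algebra_simps intro!: Kfun_cong)
  have flip: "(p - q) \<bullet> (y' - y) = (q - p) \<bullet> (y - y')" for p q :: "real ^ 'd"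
    by (simp add: inner_diff_left inner_diff_right)
  show ?thesis
  proof (intro conjI impI)
    assume eq: "\<forall>i\<le>N. a i = a' i"
    show "norm (Kfun N \<alpha> (norm y') a *\<^sub>R y' - Kfun N \<alpha> (norm y) a *\<^sub>R y)
        \<le> (1 + deg_exp N \<alpha>) * norm (y' - y) * integral {0..1} (\<lambda>t. Kfun N \<alpha> (norm (seg_pt y y' t)) a)"
      using bounds(1) unfolding equal_coeffs[OF eq] by (simp add: norm_minus_commute)
    show "(1 - deg_exp N \<alpha>) * (norm (y' - y))\<^sup>2 * integral {0..1} (\<lambda>t. Kfun N \<alpha> (norm (seg_pt y y' t)) a)
        \<le> (Kfun N \<alpha> (norm y') a *\<^sub>R y' - Kfun N \<alpha> (norm y) a *\<^sub>R y) \<bullet> (y' - y)"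
      using bounds(2) unfolding equal_coeffs[OF eq] flip by (simp add: norm_minus_commute)
  qed (use bounds in \<open>simp_all add: algebra_simps\<close>)
qed

end
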